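(* Let $\mathcal{C}$ be a contact sequence and let $\mathcal{K}_{\mathrm{ST}}=\mathcal{K}_{\mathrm{ST}}(\mathcal{C})$ be its spatiotemporal prism complex with maximum slice gap $K\ge 1$, equipped with positive simplex weights $w$. Let $e=\{u,v\}$ and let $e^{(k)}=\{(u,t_k),(v,t_k)\}\in\mathcal{K}_{\mathrm{ST}}^{(1)}$ be a spatial edge. Then $$\mathbf{F}_{\mathcal{K}_{\mathrm{ST}}}(e^{(k)})=\mathbf{F}_{F_{t_k}}(e)+\Delta_{\mathrm{prism}}(e^{(k)}),$$ where $$\Delta_{\mathrm{prism}}(e^{(k)})=w(e^{(k)})\sum_{T\in\mathrm{cof}_2^{\mathrm{prism}}(e^{(k)})}\frac{w(e^{(k)})}{w(T)}-w(e^{(k)})\,\Omega(e^{(k)}),\qquad \Omega(e^{(k)})=\sum_{\hat e\in\mathcal{P}_{\mathrm{prism}}(e^{(k)})}\frac{w(v(\hat e))}{\sqrt{w(e^{(k)})\,w(\hat e)}},$$ and $v(\hat e)$ is the unique common vertex of $\hat e$ and $e^{(k)}$.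
   Context: Simplicial complexes are finite collections of nonempty finite sets closed under nonempty subsets; $\mathcal{K}^{(k)}$ is the set of $k$-simplices of $\mathcal{K}$. Contact sequence: a finite set $\mathcal{C}=\{(i_k,j_k,t_k):k=1,\dots,N\}\subset V\times V\times\mathbb{R}$ with $i_k\ne j_k$. $T(\mathcal{C})=\{t_0<t_1<\cdots<t_M\}$ is the set of times occurring in $\mathcal{C}$ (active times). For $t\in T(\mathcal{C})$, $G_t$ is the graph with edges $\{i,j\}$ for $(i,j,t)\in\mathcal{C}$ and vertices the endpoints of these edges. $F_t$ is the flag (clique) complex of $G_t$, its vertices $v$ being embedded as spacetime vertices $(v,t)$. When writing $F_t\cap F_{t'}$ or $\sigma\in F_t$ with $\sigma\subset V$, simplices are identified with their underlying subsets of $V$. Fix a total order on $V$. Prism operator: for times $t<t'$ and $\sigma=\{v_0<\cdots<v_n\}\in F_t\cap F_{t'}$, put $\hat v_i=(v_i,t)$, $w_i=(v_i,t')$. $\mathrm{Pr}(\sigma;t,t')$ is the simplicial complex consisting of all faces of the simplices $S_i=\{\hat v_0,\dots,\hat v_i,w_i,\dots,w_n\}$, $i=0,\dots,n$. Spatiotemporal prism complex with maximum slice gap $K$: $\mathcal{K}_{\mathrm{ST}}(\mathcal{C})=\bigcup_{t\in T(\mathcal{C})}F_t\cup\bigcup_{(t,t')\in\mathcal{T}_K}\bigcup_{\sigma\in F_t\cap F_{t'}}\mathrm{Pr}(\sigma;t,t')$, where $\mathcal{T}_K=\{(t_i,t_j)\in T(\mathcal{C})^2:0<j-i\le K\}$.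 A spatial edge at time $t_k$ is a $1$-simplex $\{(u,t_k),(v,t_k)\}$. Parallelism in a simplicial complex $\mathcal{K}$: $1$-simplices $e,\hat e$ are parallel, $\hat e\Vert e$, if $\hat e\ne e$ and exactly one of the following holds: (A) some $2$-simplex of $\mathcal{K}$ contains both; (B) they have a common vertex. $\mathcal{P}(e)$ is the set of $1$-simplices parallel to $e$ (in $\mathcal{K}_{\mathrm{ST}}$); such an $\hat e$ shares exactly one vertex $v(\hat e)$ with $e$. Forman--Ricci curvature of a $1$-simplex $e$ in a complex $\mathcal{K}$ with positive weights $w$: $$\mathbf{F}_{\mathcal{K}}(e)=w(e)\Biggl[\sum_{T\in\mathcal{K}^{(2)},\,T\supset e}\frac{w(e)}{w(T)}+\sum_{x\in e}\frac{w(x)}{w(e)}-\sum_{\hat e\Vert e}\Biggl|\sum_{T\in\mathcal{K}^{(2)},\,T\supset e,\hat e}\frac{\sqrt{w(e)w(\hat e)}}{w(T)}-\sum_{x\in e\cap\hat e}\frac{w(x)}{\sqrt{w(e)w(\hat e)}}\Biggr|\Biggr].$$ $\mathbf{F}_{\mathcal{K}_{\mathrm{ST}}}(e^{(k)})$ is computed in $\mathcal{K}_{\mathrm{ST}}$; $\mathbf{F}_{F_{t_k}}(e)$ is the curvature of $e$ (i.e. of $e^{(k)}$) computed solely within the subcomplex $F_{t_k}$ (cofaces and parallelism taken in $F_{t_k}$, weights restricted from $\mathcal{K}_{\mathrm{ST}}$). Prism-origin sets: $\mathrm{cof}_2^{\mathrm{prism}}(e^{(k)})=\{T\in\mathcal{K}_{\mathrm{ST}}^{(2)}:T\supset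 e^{(k)},\ T\notin F_{t_k}\}$ and $\mathcal{P}_{\mathrm{prism}}(e^{(k)})=\{\hat e\in\mathcal{P}(e^{(k)}):\hat e\notin F_{t_k}\}$. *)

theory Defs
  imports Complex_Main
begin

definition simplicial_complex :: "'a set set \<Rightarrow> bool" where
  "simplicial_complex X \<longleftrightarrow>
     finite X \<and> (\<forall>\<sigma>\<in>X. finite \<sigma> \<and> \<sigma> \<noteq> {}) \<and>
     (\<forall>\<sigma>\<in>X. \<forall>\<tau>. \<tau> \<subseteq> \<sigma> \<and> \<tau> \<noteq> {} \<longrightarrow> \<tau> \<in> X)"

definition simplices :: "'a set set \<Rightarrow> nat \<Rightarrow> 'a set set" where
  "simplices X n = {\<sigma> \<in> X. card \<sigma> = n + 1}"


(* The vertex set with its fixed total order is the type 'v::linorder. *)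

definition contact_sequence :: "('v \<times> 'v \<times> real) set \<Rightarrow> bool" where
  "contact_sequence C \<longleftrightarrow> finite C \<and> (\<forall>(i, j, t)\<in>C. i \<noteq> j)"

definition active_times :: "('v \<times> 'v \<times> real) set \<Rightarrow> real set" where
  "active_times C = {t. \<exists>i j. (i, j, t) \<in> C}"

(* Increasing enumeration t_0 < t_1 < ... of the active times;
   meaningful for k < card (active_times C) only. *)
definition active_time :: "('v \<times> 'v \<times> real) set \<Rightarrow> nat \<Rightarrow> real" where
  "active_time C k = sorted_list_of_set (active_times C) ! k"

definition contact_edges :: "('v \<times> 'v \<times> real) set \<Rightarrow> real \<Rightarrow> 'v set set" where
  "contact_edges C t = {{i, j} | i j. (i, j, t) \<in> C}"

definition contact_verts :: "('v \<times> 'v \<times> real) set \<Rightarrow> real \<Rightarrow> 'v set" where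
  "contact_verts C t = \<Union>(contact_edges C t)"

(* Simplices as subsets of 'v, not yet placed in spacetime. *)
definition flag_complex :: "('v \<times> 'v \<times> real) set \<Rightarrow> real \<Rightarrow> 'v set set" where
  "flag_complex C t =
     {\<sigma>. finite \<sigma> \<and> \<sigma> \<noteq> {} \<and> \<sigma> \<subseteq> contact_verts C t \<and>
         (\<forall>x\<in>\<sigma>. \<forall>y\<in>\<sigma>. x \<noteq> y \<longrightarrow> {x, y} \<in> contact_edges C t)}"

definition at_time :: "real \<Rightarrow> 'v set \<Rightarrow> ('v \<times> real) set" where
  "at_time t \<sigma> = (\<lambda>v. (v, t)) ` \<sigma>"

definition slice_complex :: "('v \<times> 'v \<times> real) set \<Rightarrow> real \<Rightarrow> ('v \<times> real) set set" where
  "slice_complex C t = at_time t ` flag_complex C t"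

definition prism_simplex ::
  "'v::linorder set \<Rightarrow> real \<Rightarrow> real \<Rightarrow> nat \<Rightarrow> ('v \<times> real) set" where
  "prism_simplex \<sigma> t t' i =
     (let vs = sorted_list_of_set \<sigma>
      in {(vs ! l, t) | l. l \<le> i} \<union> {(vs ! l, t') | l. i \<le> l \<and> l < card \<sigma>})"

definition prism :: "'v::linorder set \<Rightarrow> real \<Rightarrow> real \<Rightarrow> ('v \<times> real) set set" where
  "prism \<sigma> t t' = {\<tau>. \<tau> \<noteq> {} \<and> (\<exists>i < card \<sigma>. \<tau> \<subseteq> prism_simplex \<sigma> t t' i)}"

definition slice_pairs :: "('v \<times> 'v \<times> real) set \<Rightarrow> nat \<Rightarrow> (real \<times> real) set" where
  "slice_pairs C K =
     {(active_time C i, active_time C j) | i j.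
        j < card (active_times C) \<and> i < j \<and> j - i \<le> K}"

definition st_complex ::
  "('v::linorder \<times> 'v \<times> real) set \<Rightarrow> nat \<Rightarrow> ('v \<times> real) set set" where
  "st_complex C K =
     (\<Union>t\<in>active_times C. slice_complex C t) \<union>
     (\<Union>(t, t')\<in>slice_pairs C K. \<Union>\<sigma>\<in>flag_complex C t \<inter> flag_complex C t'. prism \<sigma> t t')"


(* The inequality of the two truth values says that exactly one of them holds. *)
definition parallel :: "'a set set \<Rightarrow> 'a set \<Rightarrow> 'a set \<Rightarrow> bool" where
  "parallel X e' e \<longleftrightarrow>
     e' \<in> simplices X 1 \<and> e \<in> simplices X 1 \<and> e' \<noteq> e \<and>
     ((\<exists>T\<in>simplices X 2. e \<subseteq> T \<and> e' \<subseteq> T) \<noteq> (e \<inter> e' \<noteq> {}))"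

definition parallel_edges :: "'a set set \<Rightarrow> 'a set \<Rightarrow> 'a set set" where
  "parallel_edges X e = {e'. parallel X e' e}"

definition forman_ricci :: "'a set set \<Rightarrow> ('a set \<Rightarrow> real) \<Rightarrow> 'a set \<Rightarrow> real" where
  "forman_ricci X w e =
     w e * ((\<Sum>T\<in>{T \<in> simplices X 2. e \<subseteq> T}. w e / w T)
          + (\<Sum>x\<in>e. w {x} / w e)
          - (\<Sum>e'\<in>parallel_edges X e.
               \<bar>(\<Sum>T\<in>{T \<in> simplices X 2. e \<subseteq> T \<and> e' \<subseteq> T}. sqrt (w e * w e') / w T)
                - (\<Sum>x\<in>e \<inter> e'. w {x} / sqrt (w e * w e'))\<bar>))"

definition common_vertex :: "'a set \<Rightarrow> 'a set \<Rightarrow> 'a" where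
  "common_vertex e e' = (THE x. x \<in> e \<inter> e')"


(* In what follows e is the spacetime edge, with both endpoints at time active_time C k. *)

definition cof2_prism ::
  "('v::linorder \<times> 'v \<times> real) set \<Rightarrow> nat \<Rightarrow> nat \<Rightarrow> ('v \<times> real) set \<Rightarrow> ('v \<times> real) set set" where
  "cof2_prism C K k e =
     {T \<in> simplices (st_complex C K) 2. e \<subseteq> T \<and> T \<notin> slice_complex C (active_time C k)}"

definition parallel_prism ::
  "('v::linorder \<times> 'v \<times> real) set \<Rightarrow> nat \<Rightarrow> nat \<Rightarrow> ('v \<times> real) set \<Rightarrow> ('v \<times> real) set set" where
  "parallel_prism C K k e =
     {e' \<in> parallel_edges (st_complex C K) e. e' \<notin> slice_complex C (active_time C k)}"

definition Omega_prism ::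
  "('v::linorder \<times> 'v \<times> real) set \<Rightarrow> nat \<Rightarrow> (('v \<times> real) set \<Rightarrow> real) \<Rightarrow> nat \<Rightarrow>
     ('v \<times> real) set \<Rightarrow> real" where
  "Omega_prism C K w k e =
     (\<Sum>e'\<in>parallel_prism C K k e. w {common_vertex e e'} / sqrt (w e * w e'))"

definition Delta_prism ::
  "('v::linorder \<times> 'v \<times> real) set \<Rightarrow> nat \<Rightarrow> (('v \<times> real) set \<Rightarrow> real) \<Rightarrow> nat \<Rightarrow>
     ('v \<times> real) set \<Rightarrow> real" where
  "Delta_prism C K w k e =
     w e * (\<Sum>T\<in>cof2_prism C K k e. w e / w T) - w e * Omega_prism C K w k e"


lemma parallel_unique_common_vertex:
  assumes "parallel X e' e"
  shows "\<exists>!x. x \<in> e \<inter> e'"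
proof -
  have c: "card e = 2" "card e' = 2" and ne: "e' \<noteq> e"
    using assms by (auto simp: parallel_def simplices_def)
  have fin: "finite e" "finite e'" using c card.infinite by fastforce+
  have nonempty: "e \<inter> e' \<noteq> {}"
  proof
    assume d: "e \<inter> e' = {}"
    then obtain T where T: "T \<in> simplices X 2" "e \<subseteq> T" "e' \<subseteq> T"
      using assms by (auto simp: parallel_def)
    have cT: "card T = 3" using T by (simp add: simplices_def)
    then have "finite T" using card.infinite by fastforce
    then have "card (e \<union> e') \<le> 3" using card_mono[of T "e \<union> e'"] T cT by simp
    then show False using card_Un_disjoint[OF fin d] c by simp
  qed
  obtain a b p q where "e = {a, b}" "a \<noteq> b" "e' = {p, q}" "p \<noteq> q"
    using c by (auto simp: card_2_iff)
  then show ?thesis using nonempty ne by auto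
qed

lemma simplicial_complex_st_complex:
  assumes "contact_sequence C"
  shows "simplicial_complex (st_complex C K)"
proof -
  have fC: "finite C" using assms by (simp add: contact_sequence_def)
  have "active_times C = (\<lambda>(i, j, t). t) ` C"
    by (force simp: active_times_def)
  then have fT: "finite (active_times C)" using fC by simp
  have fV: "finite (contact_verts C t)" for t
  proof -
    have "contact_verts C t \<subseteq> fst ` C \<union> (fst \<circ> snd) ` C"
      by (force simp: contact_verts_def contact_edges_def)
    then show ?thesis using fC finite_subset by blast
  qed
  have fF: "finite (flag_complex C t)" for t
    by (rule finite_subset[of _ "Pow (contact_verts C t)"])
       (auto simp: flag_complex_def fV)
  have fS: "finite (prism_simplex \<sigma> t t' i)" for \<sigma> :: "'a set" and t t' i
    by (simp add: prism_simplex_def Let_def)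
  have fP: "finite (prism \<sigma> t t')" for \<sigma> :: "'a set" and t t'
    by (rule finite_subset[of _ "\<Union>i<card \<sigma>. Pow (prism_simplex \<sigma> t t' i)"])
       (auto simp: prism_def fS)
  have "slice_pairs C K \<subseteq>
      (\<lambda>(i, j). (active_time C i, active_time C j)) `
        ({..<card (active_times C)} \<times> {..<card (active_times C)})"
    by (force simp: slice_pairs_def)
  then have fSP: "finite (slice_pairs C K)" using finite_subset by blast
  have "finite (st_complex C K)"
    unfolding st_complex_def slice_complex_def using fT fF fP fSP by auto
  moreover have "finite \<sigma> \<and> \<sigma> \<noteq> {}" if "\<sigma> \<in> st_complex C K" for \<sigma>
  proof -
    have "finite \<sigma> \<and> \<sigma> \<noteq> {}" if "\<sigma> \<in> slice_complex C t" for t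
      using that by (auto simp: slice_complex_def at_time_def flag_complex_def)
    moreover have "finite \<sigma> \<and> \<sigma> \<noteq> {}" if "\<sigma> \<in> prism \<rho> t t'" for \<rho> t t'
      using that finite_subset[OF _ fS] unfolding prism_def by blast
    ultimately show ?thesis using that unfolding st_complex_def by blast
  qed
  moreover have "\<tau> \<in> st_complex C K" if "\<sigma> \<in> st_complex C K" "\<tau> \<subseteq> \<sigma>" "\<tau> \<noteq> {}" for \<sigma> \<tau>
  proof -
    have slice: "\<tau> \<in> slice_complex C t" if \<sigma>: "\<sigma> \<in> slice_complex C t" for t
    proof -
      obtain \<rho> where \<rho>: "\<rho> \<in> flag_complex C t" "\<sigma> = at_time t \<rho>"
        using \<sigma> by (auto simp: slice_complex_def)
      obtain \<rho>' where \<rho>': "\<rho>' \<subseteq> \<rho>" "\<tau> = at_time t \<rho>'"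
        using \<rho> \<open>\<tau> \<subseteq> \<sigma>\<close> unfolding at_time_def by (meson subset_imageE)
      then have "\<rho>' \<noteq> {}" using \<open>\<tau> \<noteq> {}\<close> by (auto simp: at_time_def)
      moreover have "finite \<rho>'"
        using \<rho> \<rho>' finite_subset unfolding flag_complex_def by blast
      ultimately have "\<rho>' \<in> flag_complex C t"
        using \<rho>(1) \<rho>'(1) unfolding flag_complex_def by blast
      then show ?thesis using \<rho>' by (auto simp: slice_complex_def)
    qed
    have prism: "\<tau> \<in> prism \<rho> t t'" if "\<sigma> \<in> prism \<rho> t t'" for \<rho> t t'
      using that \<open>\<tau> \<subseteq> \<sigma>\<close> \<open>\<tau> \<noteq> {}\<close> unfolding prism_def by blast
    from that(1) consider t where "t \<in> active_times C" "\<sigma> \<in> slice_complex C t"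
      | t t' \<rho> where "(t, t') \<in> slice_pairs C K"
          "\<rho> \<in> flag_complex C t \<inter> flag_complex C t'" "\<sigma> \<in> prism \<rho> t t'"
      unfolding st_complex_def by blast
    then show ?thesis
    proof cases
      case 1
      then show ?thesis using slice unfolding st_complex_def by (intro UnI1 UN_I)
    next
      case (2 t t' \<rho>)
      have "\<tau> \<in> (\<Union>\<rho>\<in>flag_complex C t \<inter> flag_complex C t'. prism \<rho> t t')"
        using 2(2) prism[OF 2(3)] by (rule UN_I)
      with 2(1) show ?thesis unfolding st_complex_def by blast
    qed
  qed
  ultimately show ?thesis unfolding simplicial_complex_def by blast
qed

end

theory Submission
  imports Defs
begin

text \<open>
  The slice at time \<open>t\<^sub>k\<close> is a full subcomplex of the spatiotemporal complex: a prism joins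
  two times \<open>t\<close> and \<open>t'\<close> over a simplex \<open>\<sigma>\<close> that lies in both slices, so the part of a prism
  simplex that lives at one of these times is a face of the copy of \<open>\<sigma>\<close> at that time and was already
  in that slice (\<open>single_time_simplex_in_slice\<close>).  The curvature formula is then a statement about
  an arbitrary full subcomplex \<open>Y\<close> of a complex \<open>X\<close> and an edge \<open>e\<close> of \<open>Y\<close>
  (\<open>forman_ricci_full_subcomplex\<close>), and it rests on two facts.

  Parallel edges always have a common vertex, so the exclusive or in the definition of parallelism
  rules out a common 2-coface.  Hence the inner coface sum in the curvature is empty, and the
  absolute value of a parallel edge reduces to the positive term of its common vertex.

  Parallelism to \<open>e\<close> of an edge \<open>e'\<close> of \<open>Y\<close> means the same in \<open>X\<close> and in \<open>Y\<close>: a triangle of \<open>X\<close>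
  that contains two different edges is their union, so its vertices are in \<open>Y\<close>, and fullness
  puts the triangle itself into \<open>Y\<close>.

  Therefore the sums over 2-cofaces and over parallel edges in \<open>X\<close> split into the same summands
  over members of \<open>Y\<close>, which give the curvature in \<open>Y\<close>, and summands over non-members of \<open>Y\<close>,
  which give the prism term.
\<close>

text \<open>
  For a simplicial complex \<open>Y\<close>, the set \<open>\<Union>Y\<close> consists of the vertices of \<open>Y\<close>.
\<close>
definition full_subcomplex :: "'a set set \<Rightarrow> 'a set set \<Rightarrow> bool" where
  "full_subcomplex Y X \<longleftrightarrow> Y \<subseteq> X \<and> (\<forall>\<sigma>\<in>X. \<sigma> \<subseteq> \<Union>Y \<longrightarrow> \<sigma> \<in> Y)"

lemma triangle_eq_Un_edges:
  assumes "card T = 3" "card e = 2" "card e' = 2" "e \<noteq> e'" "e \<subseteq> T" "e' \<subseteq> T"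
  shows "T = e \<union> e'"
proof -
  have fin: "finite T" "finite e" "finite e'"
    using assms(1-3) card.infinite by fastforce+
  have "\<not> e' \<subseteq> e"
    using card_subset_eq[OF fin(2)] assms(2-4) by metis
  then have "card e < card (e \<union> e')"
    using fin by (intro psubset_card_mono) auto
  then show ?thesis
    using card_seteq[OF fin(1), of "e \<union> e'"] assms by auto
qed

text \<open>
  Only triangles need an argument: those that witness parallelism of two edges of \<open>Y\<close> are unions
  of these edges.
\<close>
lemma parallel_edges_full_subcomplex:
  assumes full: "full_subcomplex Y X" and e: "e \<in> Y"
  shows "parallel_edges Y e = parallel_edges X e \<inter> Y"
proof -
  have sub: "simplices Y n = simplices X n \<inter> Y" for n
    using full by (auto simp: simplices_def full_subcomplex_def)
  have "T \<in> Y"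
    if "e' \<in> Y" "card e = 2" "card e' = 2" "e' \<noteq> e" "T \<in> simplices X 2" "e \<subseteq> T" "e' \<subseteq> T" for e' T
  proof -
    have "T = e \<union> e'"
      using that by (intro triangle_eq_Un_edges) (auto simp: simplices_def)
    then have "T \<subseteq> \<Union>Y" using e that(1) by blast
    then show ?thesis using full that(5) by (simp add: full_subcomplex_def simplices_def)
  qed
  then have triangles: "(\<exists>T\<in>simplices Y 2. e \<subseteq> T \<and> e' \<subseteq> T) \<longleftrightarrow> (\<exists>T\<in>simplices X 2. e \<subseteq> T \<and> e' \<subseteq> T)"
    if "e' \<in> Y" "card e = 2" "card e' = 2" "e' \<noteq> e" for e'
    using that unfolding sub by blast
  have edge: "card \<sigma> = 2" if "\<sigma> \<in> simplices X 1" for \<sigma>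
    using that by (simp add: simplices_def)
  have "parallel Y e' e \<longleftrightarrow> parallel X e' e \<and> e' \<in> Y" for e'
  proof (cases "e' \<in> Y \<and> e' \<in> simplices X 1 \<and> e \<in> simplices X 1 \<and> e' \<noteq> e")
    case True
    then show ?thesis
      using triangles[of e'] edge e unfolding parallel_def sub[of 1] by simp
  next
    case False
    then show ?thesis unfolding parallel_def sub[of 1] by blast
  qed
  then show ?thesis unfolding parallel_edges_def by blast
qed

text \<open>
  The empty coface set comes from the exclusive or in the definition of parallelism: the first
  alternative fails because the second one always holds.
\<close>
lemma parallel_summand:
  fixes w :: "'a set \<Rightarrow> real"
  assumes par: "e' \<in> parallel_edges X e"
    and pos: "\<And>x. x \<in> e \<Longrightarrow> w {x} \<ge> 0" "w e \<ge> 0" "w e' \<ge> 0"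
  shows "\<bar>(\<Sum>T\<in>{T \<in> simplices X 2. e \<subseteq> T \<and> e' \<subseteq> T}. sqrt (w e * w e') / w T)
            - (\<Sum>x\<in>e \<inter> e'. w {x} / sqrt (w e * w e'))\<bar>
         = w {common_vertex e e'} / sqrt (w e * w e')"
proof -
  have par': "parallel X e' e" using par by (simp add: parallel_edges_def)
  obtain x where x: "e \<inter> e' = {x}"
    using parallel_unique_common_vertex[OF par'] by blast
  then have no_coface: "{T \<in> simplices X 2. e \<subseteq> T \<and> e' \<subseteq> T} = {}"
    using par' by (auto simp: parallel_def)
  have "common_vertex e e' = x" by (simp add: common_vertex_def x)
  moreover have "w {x} \<ge> 0" using pos(1) x by blast
  then have "w {x} / sqrt (w e * w e') \<ge> 0" using pos(2,3) by simp
  ultimately show ?thesis unfolding no_coface x by (simp del: abs_divide)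
qed

text \<open>
  Both curvatures are brought to a form without absolute values; after that only the index sets
  differ, and they are split into members and non-members of \<open>Y\<close>.
\<close>
theorem forman_ricci_full_subcomplex:
  fixes w :: "'a set \<Rightarrow> real"
  assumes X: "simplicial_complex X"
    and full: "full_subcomplex Y X"
    and pos: "\<forall>\<sigma>\<in>X. w \<sigma> > 0"
    and e: "e \<in> Y"
  shows "forman_ricci X w e = forman_ricci Y w e
           + (w e * (\<Sum>T\<in>{T \<in> simplices X 2. e \<subseteq> T \<and> T \<notin> Y}. w e / w T)
              - w e * (\<Sum>e'\<in>{e' \<in> parallel_edges X e. e' \<notin> Y}.
                         w {common_vertex e e'} / sqrt (w e * w e')))"
proof -
  have sub: "Y \<subseteq> X" using full by (simp add: full_subcomplex_def)
  have finX: "finite X" using X by (simp add: simplicial_complex_def)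
  have eX: "e \<in> X" using e sub by blast
  have nonneg: "w \<sigma> \<ge> 0" if "\<sigma> \<in> X" for \<sigma>
    using bspec[OF pos that] by (rule order.strict_implies_order)
  have face: "\<tau> \<in> X" if "\<tau> \<subseteq> e" "\<tau> \<noteq> {}" for \<tau>
    using X eX that unfolding simplicial_complex_def by metis
  define g where "g e' = w {common_vertex e e'} / sqrt (w e * w e')" for e'
  define f where "f T = w e / w T" for T
  have curvature: "forman_ricci Z w e =
      w e * (sum f {T \<in> simplices Z 2. e \<subseteq> T} + (\<Sum>x\<in>e. w {x} / w e) - sum g (parallel_edges Z e))"
    if "Z \<subseteq> X" for Z
  proof -
    have "\<bar>(\<Sum>T\<in>{T \<in> simplices Z 2. e \<subseteq> T \<and> e' \<subseteq> T}. sqrt (w e * w e') / w T)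
            - (\<Sum>x\<in>e \<inter> e'. w {x} / sqrt (w e * w e'))\<bar> = g e'"
      if e': "e' \<in> parallel_edges Z e" for e'
      unfolding g_def
    proof (rule parallel_summand[OF e'])
      show "w {x} \<ge> 0" if "x \<in> e" for x
        using that by (intro nonneg face) auto
      show "w e \<ge> 0" by (rule nonneg[OF eX])
      have "e' \<in> X"
        using e' \<open>Z \<subseteq> X\<close> by (auto simp: parallel_edges_def parallel_def simplices_def)
      then show "w e' \<ge> 0" by (rule nonneg)
    qed
    then show ?thesis unfolding forman_ricci_def f_def by simp
  qed
  have cofaces: "sum f {T \<in> simplices X 2. e \<subseteq> T} =
      sum f {T \<in> simplices Y 2. e \<subseteq> T} + sum f {T \<in> simplices X 2. e \<subseteq> T \<and> T \<notin> Y}"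
  proof -
    have "{T \<in> simplices Y 2. e \<subseteq> T} = {T \<in> simplices X 2. e \<subseteq> T} \<inter> Y"
      using sub by (auto simp: simplices_def)
    moreover have "{T \<in> simplices X 2. e \<subseteq> T \<and> T \<notin> Y} = {T \<in> simplices X 2. e \<subseteq> T} - Y" by blast
    moreover have "finite {T \<in> simplices X 2. e \<subseteq> T}" using finX by (simp add: simplices_def)
    ultimately show ?thesis
      using sum.Int_Diff[of "{T \<in> simplices X 2. e \<subseteq> T}" f Y] by simp
  qed
  have parallels: "sum g (parallel_edges X e) =
      sum g (parallel_edges Y e) + sum g {e' \<in> parallel_edges X e. e' \<notin> Y}"
  proof -
    have "finite (parallel_edges X e)"
      by (rule finite_subset[OF _ finX])
         (auto simp: parallel_edges_def parallel_def simplices_def)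
    moreover have "{e' \<in> parallel_edges X e. e' \<notin> Y} = parallel_edges X e - Y" by blast
    ultimately show ?thesis
      unfolding parallel_edges_full_subcomplex[OF full e]
      using sum.Int_Diff[of "parallel_edges X e" g Y] by simp
  qed
  show ?thesis
    unfolding curvature[OF order_refl] curvature[OF sub] cofaces parallels
    unfolding f_def[symmetric] g_def[symmetric] by (simp add: algebra_simps)
qed

lemma flag_complex_face:
  "\<sigma> \<in> flag_complex C t \<Longrightarrow> \<tau> \<subseteq> \<sigma> \<Longrightarrow> \<tau> \<noteq> {} \<Longrightarrow> \<tau> \<in> flag_complex C t"
  unfolding flag_complex_def using finite_subset by blast

text \<open>
  The vertices of a prism simplex are vertices of \<open>\<sigma>\<close> placed at \<open>t\<close> or at \<open>t'\<close>, so forgetting the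
  time of a face of a prism returns a face of \<open>\<sigma>\<close>.
\<close>
lemma fst_prism_subset:
  assumes "\<tau> \<in> prism \<sigma> t t'"
  shows "fst ` \<tau> \<subseteq> \<sigma>"
proof -
  obtain i where i: "i < card \<sigma>" "\<tau> \<subseteq> prism_simplex \<sigma> t t' i"
    using assms by (auto simp: prism_def)
  then have "finite \<sigma>" using card.infinite by fastforce
  then have "sorted_list_of_set \<sigma> ! l \<in> \<sigma>" if "l < card \<sigma>" for l
    using that nth_mem[of l "sorted_list_of_set \<sigma>"] by simp
  then have "fst ` prism_simplex \<sigma> t t' i \<subseteq> \<sigma>"
    using i(1) by (auto simp: prism_simplex_def Let_def)
  then show ?thesis using i(2) by blast
qed

text \<open>
  Prisms create no simplex inside a single slice: a prism is built over a simplex of both of its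
  end slices, and its vertices sit at these two times only.
\<close>
lemma single_time_simplex_in_slice:
  assumes \<tau>: "\<tau> \<in> st_complex C K" and time: "snd ` \<tau> \<subseteq> {s}"
  shows "\<tau> \<in> slice_complex C s"
proof -
  have placed: "\<tau> = at_time s (fst ` \<tau>)"
    using time by (force simp: at_time_def)
  have "fst ` \<tau> \<in> flag_complex C s"
  proof -
    from \<tau> consider t where "\<tau> \<in> slice_complex C t"
      | t t' \<sigma> where "\<sigma> \<in> flag_complex C t" "\<sigma> \<in> flag_complex C t'" "\<tau> \<in> prism \<sigma> t t'"
      unfolding st_complex_def by blast
    then show ?thesis
    proof cases
      case (1 t)
      then obtain \<rho> where \<rho>: "\<rho> \<in> flag_complex C t" "\<tau> = at_time t \<rho>"
        by (auto simp: slice_complex_def)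
      moreover from \<rho>(1) have "\<rho> \<noteq> {}" by (simp add: flag_complex_def)
      ultimately have "t = s" "fst ` \<tau> = \<rho>"
        using time by (auto simp: at_time_def image_image)
      then show ?thesis using \<rho> by simp
    next
      case (2 t t' \<sigma>)
      have ne: "\<tau> \<noteq> {}" using 2(3) by (simp add: prism_def)
      have "snd ` \<tau> \<subseteq> {t, t'}"
        using 2(3) by (fastforce simp: prism_def prism_simplex_def Let_def)
      then have "s = t \<or> s = t'" using time ne by blast
      then have "\<sigma> \<in> flag_complex C s" using 2 by auto
      then show ?thesis using flag_complex_face fst_prism_subset[OF 2(3)] ne by blast
    qed
  qed
  then show ?thesis unfolding slice_complex_def using placed by blast
qed

lemma full_subcomplex_slice:
  assumes "t \<in> active_times C"
  shows "full_subcomplex (slice_complex C t) (st_complex C K)"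
  unfolding full_subcomplex_def
proof (intro conjI ballI impI)
  show "slice_complex C t \<subseteq> st_complex C K"
    using assms unfolding st_complex_def by blast
next
  fix \<sigma> assume \<sigma>: "\<sigma> \<in> st_complex C K" "\<sigma> \<subseteq> \<Union>(slice_complex C t)"
  then have "snd ` \<sigma> \<subseteq> {t}" by (auto simp: slice_complex_def at_time_def)
  then show "\<sigma> \<in> slice_complex C t" using \<sigma>(1) by (rule single_time_simplex_in_slice[rotated])
qed

lemma active_time_in_active_times:
  assumes "k < card (active_times C)"
  shows "active_time C k \<in> active_times C"
proof -
  have "finite (active_times C)" using assms card.infinite by fastforce
  then show ?thesis
    using assms nth_mem[of k "sorted_list_of_set (active_times C)"] by (simp add: active_time_def)
qed

theorem lemma7:
  fixes C :: "('v::linorder \<times> 'v \<times> real) set"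
    and K k :: nat
    and w :: "('v \<times> real) set \<Rightarrow> real"
    and u v :: 'v
    and e :: "'v set"
  assumes "contact_sequence C"
    and "K \<ge> 1"
    and "\<forall>\<sigma>\<in>st_complex C K. w \<sigma> > 0"
    and "k < card (active_times C)"
    and "e = {u, v}"
    and "at_time (active_time C k) e \<in> simplices (st_complex C K) 1"
  shows "forman_ricci (st_complex C K) w (at_time (active_time C k) e) =
           forman_ricci (slice_complex C (active_time C k)) w (at_time (active_time C k) e)
           + Delta_prism C K w k (at_time (active_time C k) e)"
proof -
  let ?t = "active_time C k"
  have "at_time ?t e \<in> slice_complex C ?t"
  proof (rule single_time_simplex_in_slice)
    show "at_time ?t e \<in> st_complex C K" using assms(6) by (simp add: simplices_def)
    show "snd ` at_time ?t e \<subseteq> {?t}" by (auto simp: at_time_def)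
  qed
  then show ?thesis
    unfolding Delta_prism_def Omega_prism_def cof2_prism_def parallel_prism_def
    using full_subcomplex_slice[OF active_time_in_active_times[OF assms(4)]] assms(3)
    by (intro forman_ricci_full_subcomplex simplicial_complex_st_complex assms(1))
qed

end
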